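(* For connected graphs $G$, $\mathscr{Z}(G)=K_2$ if and only if $G=P_n$ for some $n\ge 2$.
   Context: All graphs are finite, simple and undirected (with nonempty vertex set); equality of graphs here means isomorphism. $K_n$ and $P_n$ denote the complete graph and the path on $n$ vertices. Zero forcing: vertices of a graph $G$ are colored blue or white; the color change rule says that a blue vertex $u$ can change the color of a white vertex $w$ to blue if $w$ is the unique white neighbor of $u$. A set $B\subseteq V(G)$ is a zero forcing set of $G$ if, starting with exactly the vertices of $B$ blue and applying the color change rule repeatedly, all vertices eventually become blue. The zero forcing number $\operatorname{Z}(G)$ is the minimum of $|B|$ over all zero forcing sets $B$ of $G$; a minimum zero forcing set is a zero forcing set $B$ with $|B|=\operatorname{Z}(G)$. The zero forcing graph $\mathscr{Z}(G)$ is the graph whose vertices are the minimum zero forcing sets of $G$, with two of them adjacent if and only if their symmetric difference has exactly two elements. *)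

theory Defs
  imports "Graph_Theory.Graph_Theory"
begin

text \<open>A finite simple undirected graph is a \<^locale>\<open>pair_graph\<close>: each undirected edge
  \<open>{u, v}\<close> is represented by the two arcs \<open>(u, v)\<close> and \<open>(v, u)\<close>.\<close>

definition path_graph :: "nat \<Rightarrow> nat pair_pre_digraph" where
  "path_graph n = \<lparr> pverts = {..<n},
     parcs = {(i, j). i < n \<and> j < n \<and> (j = Suc i \<or> i = Suc j)} \<rparr>"

definition graph_iso :: "'a pair_pre_digraph \<Rightarrow> 'b pair_pre_digraph \<Rightarrow> bool" where
  "graph_iso G H \<longleftrightarrow> digraph_iso (with_proj G) (with_proj H)"

definition white_neighbors :: "'a pair_pre_digraph \<Rightarrow> 'a set \<Rightarrow> 'a \<Rightarrow> 'a set" where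
  "white_neighbors G S u = {w \<in> pverts G - S. (u, w) \<in> parcs G}"

text \<open>One application of the color change rule; the states are the sets of blue vertices.\<close>

inductive color_change :: "'a pair_pre_digraph \<Rightarrow> 'a set \<Rightarrow> 'a set \<Rightarrow> bool"
  for G :: "'a pair_pre_digraph" where
  force: "u \<in> S \<Longrightarrow> white_neighbors G S u = {w} \<Longrightarrow> color_change G S (insert w S)"

definition zero_forcing_set :: "'a pair_pre_digraph \<Rightarrow> 'a set \<Rightarrow> bool" where
  "zero_forcing_set G B \<longleftrightarrow> B \<subseteq> pverts G \<and> (color_change G)\<^sup>*\<^sup>* B (pverts G)"

definition zero_forcing_number :: "'a pair_pre_digraph \<Rightarrow> nat" where
  "zero_forcing_number G = Min (card ` {B. zero_forcing_set G B})"

definition min_zero_forcing_set :: "'a pair_pre_digraph \<Rightarrow> 'a set \<Rightarrow> bool" where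
  "min_zero_forcing_set G B \<longleftrightarrow> zero_forcing_set G B \<and> card B = zero_forcing_number G"

definition zero_forcing_graph :: "'a pair_pre_digraph \<Rightarrow> 'a set pair_pre_digraph" where
  "zero_forcing_graph G = \<lparr> pverts = {B. min_zero_forcing_set G B},
     parcs = {(B, B'). min_zero_forcing_set G B \<and> min_zero_forcing_set G B' \<and>
                       card (sym_diff B B') = 2} \<rparr>"

end

theory Submission
  imports Defs
begin

text \<open>Reversing all forces of a zero forcing process that starts in \<open>B\<close> gives a process that starts
  in the set of vertices performing no force, which has the same size as \<open>B\<close>. Hence, if a vertex \<open>v\<close>
  belonged to every minimum zero forcing set of a connected graph with at least two vertices, it
  would never perform a force. But the neighbor of \<open>v\<close> that turns blue last can be forced by \<open>v\<close>, and if
  it is blue from the beginning it can be dropped from \<open>B\<close>. So no vertex lies in every minimum zero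
  forcing set, the two vertices of \<open>K\<^sub>2\<close> are disjoint sets with symmetric difference of size two,
  and \<open>Z(G) = 1\<close>. A single forcing chain that covers \<open>G\<close> makes \<open>G\<close> a path.\<close>

section \<open>Reversal of forces\<close>

text \<open>\<open>color_change\<close> keeps only the blue sets. Reversal also has to know who
  forced, so \<open>F\<close> accumulates the forcing vertices.\<close>

inductive forced_by :: "'a pair_pre_digraph \<Rightarrow> 'a set \<Rightarrow> 'a set \<Rightarrow> 'a set \<Rightarrow> bool"
  for G :: "'a pair_pre_digraph" and B :: "'a set" where
  start: "forced_by G B B {}"
| step: "forced_by G B S F \<Longrightarrow> u \<in> S \<Longrightarrow> white_neighbors G S u = {w} \<Longrightarrow>
    forced_by G B (insert w S) (insert u F)"

lemma forced_by_extend: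
  assumes "(color_change G)\<^sup>*\<^sup>* S T" "forced_by G B S F"
  shows "\<exists>F'. F \<subseteq> F' \<and> forced_by G B T F'"
  using assms
proof (induction rule: rtranclp_induct)
  case base
  then show ?case by blast
next
  case (step T T')
  then obtain F' where F': "F \<subseteq> F'" "forced_by G B T F'" by blast
  from step(2) obtain u w where "u \<in> T" "white_neighbors G T u = {w}" "T' = insert w T"
    by (auto elim: color_change.cases)
  with F' have "forced_by G B T' (insert u F')" by (auto intro: forced_by.step)
  with F'(1) show ?case by blast
qed

text \<open>After its force a vertex has no white neighbor, so it never forces again; hence each
  step enlarges \<open>S\<close> and \<open>F\<close> by one vertex each. When \<open>u\<close>
  forces \<open>w\<close>, the reversed process starts with \<open>w\<close> forcing
  \<open>u\<close>. The five claims support each other and are proved in one induction.\<close>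

lemma (in pair_graph) reverse_forces:
  assumes "forced_by G B S F" "B \<subseteq> pverts G"
  shows "F \<subseteq> S" "S \<subseteq> pverts G" "\<And>u. u \<in> F \<Longrightarrow> white_neighbors G S u = {}"
    "card S = card B + card F" "(color_change G)\<^sup>*\<^sup>* (pverts G - F) (pverts G)"
  using assms(1)
proof (induction)
  case start
  { case 1 show ?case by simp }
  { case 2 show ?case by (fact assms(2)) }
  { case 3 then show ?case by simp }
  { case 4 show ?case by simp }
  { case 5 show ?case by simp }
next
  case (step S F u w)
  have w: "w \<in> pverts G" "w \<notin> S" "(u, w) \<in> parcs G"
    using step.hyps(3) unfolding white_neighbors_def by blast+
  \<comment> \<open>Earlier forcers have no white neighbors, but \<open>u\<close> still has
    \<open>w\<close>.\<close>
  have u: "u \<notin> F" using step.IH(3) step.hyps(3) by fastforce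
  have fin: "finite S" "finite F"
    using finite_subset[OF _ pair_finite_verts] step.IH(1,2) by auto
  { case 1 show ?case using step by blast }
  { case 2 show ?case using step w by blast }
  { case (3 x)
    then show ?case using step.IH(3) step.hyps(3) unfolding white_neighbors_def by blast }
  { case 4 show ?case using step.IH(4) w u fin by simp }
  { case 5
    \<comment> \<open>The white vertices of the reversed state are the forcers. Those in
      \<open>F\<close> have no neighbor outside \<open>S\<close>, so they are not adjacent to
      \<open>w\<close>; only \<open>u\<close> is.\<close>
    have "white_neighbors G (pverts G - insert u F) w = {u}"
      using step.IH(1-3) step.hyps(2) w unfolding white_neighbors_def
      by (blast dest: arcs_symmetric)
    moreover have "w \<in> pverts G - insert u F"
      using w step.IH(1) step.hyps(2) by blast
    ultimately have "color_change G (pverts G - insert u F) (insert u (pverts G - insert u F))"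
      by (intro color_change.force)
    moreover have "insert u (pverts G - insert u F) = pverts G - F"
      using u step.IH(2) step.hyps(2) by blast
    ultimately show ?case using step.IH(5) by (metis converse_rtranclp_into_rtranclp) }
qed

text \<open>Let \<open>v\<close> perform the force of \<open>w\<close> and run the process to the
  end. The vertices that never force are again zero forcing by reversal, and \<open>v\<close> is not
  among them.\<close>

lemma (in pair_graph) zero_forcing_set_avoiding_forcer:
  assumes "B \<subseteq> pverts G" "(color_change G)\<^sup>*\<^sup>* B S" "v \<in> S" "white_neighbors G S v = {w}"
    "(color_change G)\<^sup>*\<^sup>* (insert w S) (pverts G)"
  shows "\<exists>B'. zero_forcing_set G B' \<and> card B' = card B \<and> v \<notin> B'"
proof -
  obtain F where "forced_by G B S F"
    using forced_by_extend[OF assms(2) forced_by.start] by blast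
  then have "forced_by G B (insert w S) (insert v F)"
    using assms(3,4) by (rule forced_by.step)
  from forced_by_extend[OF assms(5) this] obtain F' where
    F': "insert v F \<subseteq> F'" "forced_by G B (pverts G) F'" by blast
  note rev = reverse_forces[OF F'(2) assms(1)]
  \<comment> \<open>The whole vertex set has \<open>card B + card F'\<close> elements.\<close>
  have "card (pverts G - F') = card B"
    using rev(1,4) pair_finite_verts by (simp add: card_Diff_subset finite_subset)
  then show ?thesis
    using rev(5) F'(1) unfolding zero_forcing_set_def by (intro exI[of _ "pverts G - F'"]) auto
qed

section \<open>Minimum zero forcing sets\<close>

lemma finite_zero_forcing_sets:
  assumes "finite (pverts G)"
  shows "finite {B. zero_forcing_set G B}"
  by (rule finite_subset[of _ "Pow (pverts G)"]) (use assms in \<open>auto simp: zero_forcing_set_def\<close>)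

lemma zero_forcing_number_le:
  assumes "finite (pverts G)" "zero_forcing_set G B"
  shows "zero_forcing_number G \<le> card B"
  unfolding zero_forcing_number_def
  using assms finite_zero_forcing_sets by (intro Min_le) auto

lemma zero_forcing_set_nonempty:
  assumes "zero_forcing_set G B" "pverts G \<noteq> {}"
  shows "B \<noteq> {}"
proof
  assume "B = {}"
  with assms(1) have "(color_change G)\<^sup>*\<^sup>* {} (pverts G)" by (simp add: zero_forcing_set_def)
  then show False using assms(2)
    by (cases rule: converse_rtranclpE) (auto elim: color_change.cases)
qed

text \<open>Vertices turn blue one at a time, so just before the last neighbor of \<open>v\<close>
  does, it is the unique white one. Another vertex may force it in the given process, but a blue
  \<open>v\<close> could do so equally well.\<close>

lemma zero_forcing_last_neighbor:
  assumes "(color_change G)\<^sup>*\<^sup>* B (pverts G)" "white_neighbors G B v \<noteq> {}"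
  shows "\<exists>S w. (color_change G)\<^sup>*\<^sup>* B S \<and> white_neighbors G S v = {w} \<and>
    (color_change G)\<^sup>*\<^sup>* (insert w S) (pverts G)"
  using assms
proof (induction rule: converse_rtranclp_induct)
  case base
  then show ?case by (simp add: white_neighbors_def)
next
  case (step S S')
  from step(1) obtain w where S': "S' = insert w S" by (auto elim: color_change.cases)
  have wn: "white_neighbors G S' v = white_neighbors G S v - {w}"
    unfolding S' white_neighbors_def by blast
  show ?case
  proof (cases "white_neighbors G S' v = {}")
    case True
    then have "white_neighbors G S v = {w}" using wn step.prems by blast
    then show ?thesis using step(2) S' by blast
  next
    case False
    then show ?thesis using step.IH step(1) by (meson converse_rtranclp_into_rtranclp)
  qed
qed

lemma color_change_subset: "(color_change G)\<^sup>*\<^sup>* B S \<Longrightarrow> B \<subseteq> S"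
  by (induction rule: rtranclp_induct) (auto elim!: color_change.cases)

text \<open>If \<open>v\<close> lies in \<open>B\<close>, minimality leaves it a white neighbor at
  the start. Then \<open>v\<close> can be made to force its last white neighbor, and reversal
  removes it from the set.\<close>

lemma (in pair_graph) min_zero_forcing_set_avoiding:
  assumes min: "min_zero_forcing_set G B" and vw: "(v, w) \<in> parcs G"
  shows "\<exists>B'. min_zero_forcing_set G B' \<and> v \<notin> B'"
proof (cases "v \<in> B")
  case False
  then show ?thesis using min by blast
next
  case True
  have B: "B \<subseteq> pverts G" "(color_change G)\<^sup>*\<^sup>* B (pverts G)" "card B = zero_forcing_number G"
    using min by (auto simp: min_zero_forcing_set_def zero_forcing_set_def)
  have "white_neighbors G B v \<noteq> {}"
  proof
    \<comment> \<open>With all neighbors of \<open>v\<close> blue at the start, \<open>w\<close> is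
      redundant: from \<open>B - {w}\<close>, the vertex \<open>v\<close> restores it at
      once.\<close>
    assume none: "white_neighbors G B v = {}"
    have w: "w \<in> B" "w \<in> pverts G" "v \<noteq> w"
      using none vw in_arcsD2[OF vw] no_loops'[OF vw] by (auto simp: white_neighbors_def)
    then have "white_neighbors G (B - {w}) v = {w}"
      using none vw unfolding white_neighbors_def by blast
    then have "color_change G (B - {w}) (insert w (B - {w}))"
      using True w by (intro color_change.force) auto
    then have "zero_forcing_set G (B - {w})"
      using B w unfolding zero_forcing_set_def
      by (metis insert_Diff converse_rtranclp_into_rtranclp Diff_subset subset_trans)
    then have "card B \<le> card (B - {w})"
      using zero_forcing_number_le[OF pair_finite_verts] B(3) by simp
    moreover have "card (B - {w}) < card B"
      using w B(1) pair_finite_verts by (meson card_Diff1_less finite_subset)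
    ultimately show False by simp
  qed
  from zero_forcing_last_neighbor[OF B(2) this] obtain S x where
    S: "(color_change G)\<^sup>*\<^sup>* B S" "white_neighbors G S v = {x}"
      "(color_change G)\<^sup>*\<^sup>* (insert x S) (pverts G)" by blast
  have "v \<in> S" using S(1) True color_change_subset by blast
  from zero_forcing_set_avoiding_forcer[OF B(1) S(1) this S(2,3)]
  show ?thesis using B(3) by (auto simp: min_zero_forcing_set_def)
qed

lemma (in pair_graph) connected_has_neighbor:
  assumes "connected (with_proj G)" "v \<in> pverts G" "pverts G \<noteq> {v}"
  shows "\<exists>w. (v, w) \<in> parcs G"
proof -
  obtain x where x: "x \<in> pverts G" "x \<noteq> v" using assms(2,3) by blast
  \<comment> \<open>\<open>connected\<close> means strong connectivity of the symmetric closure, so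
    the walk is found there. Its first arc is an arc of \<open>G\<close> up to direction.\<close>
  have "v \<rightarrow>\<^sup>*\<^bsub>with_proj (mk_symmetric (with_proj G))\<^esub> x"
    using assms(1,2) x(1)
    by (auto simp: connected_def strongly_connected_def mk_symmetric_def)
  then have "(v, x) \<in> (parcs (mk_symmetric (with_proj G)))\<^sup>*"
    using reachable_rtranclI by fastforce
  then obtain w where "(v, w) \<in> parcs (mk_symmetric (with_proj G))"
    using x(2) by (metis converse_rtranclE)
  then have "(v, w) \<in> parcs G \<or> (w, v) \<in> parcs G" by (auto simp: mk_symmetric_def)
  then show ?thesis by (blast dest: arcs_symmetric)
qed

section \<open>Paths\<close>

text \<open>The subgraph induced on \<open>S\<close> is a path, listed in order by \<open>f\<close>.
  The set \<open>S\<close> is a parameter so that the notion also applies to the blue set in the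
  middle of a process.\<close>

definition path_enumeration :: "'a pair_pre_digraph \<Rightarrow> 'a set \<Rightarrow> nat \<Rightarrow> (nat \<Rightarrow> 'a) \<Rightarrow> bool" where
  "path_enumeration G S n f \<longleftrightarrow> bij_betw f {..<n} S \<and>
    (\<forall>i<n. \<forall>j<n. (f i, f j) \<in> parcs G \<longleftrightarrow> j = Suc i \<or> i = Suc j)"

lemma (in pair_wf_digraph) graph_iso_path_graphI:
  assumes "path_enumeration G (pverts G) n f"
  shows "graph_iso G (path_graph n)"
proof -
  define g where "g = the_inv_into {..<n} f"
  \<comment> \<open>An isomorphism record also carries a map of arcs and new projections. As arcs
    are pairs, \<open>g\<close> acts on both ends.\<close>
  define h where "h = \<lparr>iso_verts = g, iso_arcs = map_prod g g, iso_head = snd, iso_tail = fst\<rparr>"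
  have f: "inj_on f {..<n}" "f ` {..<n} = pverts G"
    and arcs: "\<And>i j. i < n \<Longrightarrow> j < n \<Longrightarrow> (f i, f j) \<in> parcs G \<longleftrightarrow> j = Suc i \<or> i = Suc j"
    using assms by (auto simp: path_enumeration_def bij_betw_def)
  have gf: "g (f i) = i" if "i < n" for i
    using f(1) that by (simp add: g_def the_inv_into_f_f)
  have fg: "f (g v) = v" "g v < n" if "v \<in> pverts G" for v
    using that gf unfolding f(2)[symmetric] by auto
  have "inj_on g (pverts G)" by (metis fg(1) inj_onI)
  moreover have "inj_on (map_prod g g) (parcs G)"
    by (rule inj_on_inverseI[of _ "map_prod f f"]) (auto intro!: fg dest: wellformed')
  ultimately have "pre_digraph.digraph_isomorphism (with_proj G) h"
    using wf_digraph by (auto simp: pre_digraph.digraph_isomorphism_def h_def)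
  moreover have "g ` pverts G = {..<n}" using f(2) gf by force
  moreover have "map_prod g g ` parcs G = parcs (path_graph n)"
  proof (intro equalityI subsetI)
    fix e assume "e \<in> map_prod g g ` parcs G"
    then obtain u v where uv: "(u, v) \<in> parcs G" "e = (g u, g v)" by auto
    then show "e \<in> parcs (path_graph n)"
      using arcs[of "g u" "g v"] fg wellformed'[OF uv(1)] by (auto simp: path_graph_def)
  next
    fix e assume "e \<in> parcs (path_graph n)"
    then obtain i j where ij: "e = (i, j)" "i < n" "j < n" "j = Suc i \<or> i = Suc j"
      by (auto simp: path_graph_def)
    then have "(f i, f j) \<in> parcs G" using arcs by blast
    moreover have "e = map_prod g g (f i, f j)" using ij gf by simp
    ultimately show "e \<in> map_prod g g ` parcs G" by blast
  qed
  ultimately have "with_proj (path_graph n) = app_iso h (with_proj G)"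
    by (simp add: with_proj_def app_iso_def h_def path_graph_def)
  then show ?thesis
    using \<open>pre_digraph.digraph_isomorphism (with_proj G) h\<close>
    unfolding graph_iso_def digraph_iso_def by blast
qed

lemma (in pair_wf_digraph) graph_iso_path_graphD:
  assumes "graph_iso G (path_graph n)"
  shows "\<exists>f. path_enumeration G (pverts G) n f"
proof -
  from assms obtain h where h: "digraph_isomorphism h"
    "with_proj (path_graph n) = app_iso h (with_proj G)"
    unfolding graph_iso_def digraph_iso_def by blast
  define g where "g = iso_verts h"
  define f where "f = the_inv_into (pverts G) g"
  have g: "inj_on g (pverts G)"
    using digraph_isomorphism_inj_on_verts[OF h(1)] by (simp add: g_def)
  have verts: "g ` pverts G = {..<n}"
    using arg_cong[OF h(2), of verts] by (simp add: path_graph_def g_def)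
  \<comment> \<open>The arc map of \<open>h\<close> is arbitrary; comparing only the end pairs of
    arcs eliminates it.\<close>
  have arcs: "parcs (path_graph n) = (\<lambda>(u,v). (g u, g v)) ` parcs G"
    using arcs_ends_app_iso_eq[OF h(1)] arg_cong[OF h(2), of arcs_ends] by (simp add: g_def)
  have gb: "bij_betw g (pverts G) {..<n}" using g verts by (simp add: bij_betw_def)
  then have f: "bij_betw f {..<n} (pverts G)"
    unfolding f_def by (rule bij_betw_the_inv_into)
  have gf: "g (f i) = i" if "i < n" for i
    unfolding f_def using that verts by (intro f_the_inv_into_f[OF g]) simp
  have "(f i, f j) \<in> parcs G \<longleftrightarrow> j = Suc i \<or> i = Suc j" if ij: "i < n" "j < n" for i j
  proof
    assume "(f i, f j) \<in> parcs G"
    then have "(g (f i), g (f j)) \<in> parcs (path_graph n)" unfolding arcs by force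
    then show "j = Suc i \<or> i = Suc j" using ij gf by (auto simp: path_graph_def)
  next
    assume "j = Suc i \<or> i = Suc j"
    then have "(i, j) \<in> parcs (path_graph n)" using ij by (auto simp: path_graph_def)
    then obtain u v where uv: "(u, v) \<in> parcs G" "i = g u" "j = g v" unfolding arcs by auto
    then have "f i = u" "f j = v"
      unfolding f_def using wellformed'[OF uv(1)] by (auto simp: the_inv_into_f_f[OF g])
    then show "(f i, f j) \<in> parcs G" using uv(1) by simp
  qed
  then show ?thesis using f by (auto simp: path_enumeration_def)
qed

section \<open>Forcing from a single vertex\<close>

text \<open>Only the last vertex of the blue path can still have white neighbors. So it performs the
  next force, and the new vertex, adjacent to no other blue vertex, prolongs the path.\<close>

lemma (in pair_graph) forcing_chain_path:
  assumes "(color_change G)\<^sup>*\<^sup>* {x} S"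
  shows "\<exists>n f. path_enumeration G S (Suc n) f \<and> (\<forall>i<n. white_neighbors G S (f i) = {})"
  using assms
proof (induction rule: rtranclp_induct)
  case base
  have "path_enumeration G {x} (Suc 0) (\<lambda>_. x)"
    using no_loops' by (auto simp: path_enumeration_def bij_betw_def lessThan_Suc)
  then show ?case by blast
next
  case (step S T)
  then obtain n f where n: "path_enumeration G S (Suc n) f"
    "\<forall>i<n. white_neighbors G S (f i) = {}" by blast
  from step(2) obtain u w where u: "u \<in> S" "white_neighbors G S u = {w}" "T = insert w S"
    by (auto elim: color_change.cases)
  have f: "bij_betw f {..<Suc n} S"
    and arcs: "\<And>i j. i < Suc n \<Longrightarrow> j < Suc n \<Longrightarrow> (f i, f j) \<in> parcs G \<longleftrightarrow> j = Suc i \<or> i = Suc j"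
    using n(1) by (auto simp: path_enumeration_def)
  obtain k where "k < Suc n" "u = f k" using u(1) f by (auto simp: bij_betw_def)
  then have un: "u = f n" using n(2) u(2) by (metis insert_not_empty less_antisym)
  have w: "w \<in> pverts G" "w \<notin> S" "(f n, w) \<in> parcs G"
    using u(2) un unfolding white_neighbors_def by blast+
  \<comment> \<open>For \<open>i < n\<close> all neighbors of \<open>f i\<close> are blue, whereas
    \<open>w\<close> is white.\<close>
  have wi: "(f i, w) \<in> parcs G \<longleftrightarrow> i = n" if "i < Suc n" for i
    using n(2) w that unfolding white_neighbors_def by (auto simp: less_Suc_eq)
  then have wi': "(w, f i) \<in> parcs G \<longleftrightarrow> i = n" if "i < Suc n" for i
    using that arcs_symmetric by blast
  have ww: "(w, w) \<notin> parcs G" using no_loops' by blast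
  define g where "g = f(Suc n := w)"
  have g: "g (Suc n) = w" "\<And>i. i < Suc n \<Longrightarrow> g i = f i" by (auto simp: g_def)
  have "bij_betw g {..<Suc n} S" using f bij_betw_cong[of "{..<Suc n}" g f] g(2) by simp
  then have "bij_betw g (insert (Suc n) {..<Suc n}) (insert (g (Suc n)) S)"
    using notIn_Un_bij_betw[of "Suc n" "{..<Suc n}" g S] w(2) g(1) by simp
  then have "bij_betw g {..<Suc (Suc n)} T"
    using u(3) g(1) by (simp add: lessThan_Suc)
  moreover have "(g i, g j) \<in> parcs G \<longleftrightarrow> j = Suc i \<or> i = Suc j"
    if "i < Suc (Suc n)" "j < Suc (Suc n)" for i j
  proof -
    consider "i < Suc n" "j < Suc n" | "i < Suc n" "j = Suc n" | "i = Suc n" "j < Suc n"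
      | "i = Suc n" "j = Suc n" using \<open>i < Suc (Suc n)\<close> \<open>j < Suc (Suc n)\<close> by (meson less_Suc_eq)
    then show ?thesis
      by cases (use arcs wi wi' g ww in auto)
  qed
  ultimately have "path_enumeration G T (Suc (Suc n)) g" by (simp add: path_enumeration_def)
  \<comment> \<open>The former end \<open>f n\<close> joins the exhausted vertices: its only white
    neighbor \<open>w\<close> is now blue.\<close>
  moreover have "white_neighbors G T (g i) = {}" if "i < Suc n" for i
    using n(2) u that un g(2)[OF that] unfolding white_neighbors_def by (cases "i = n") auto
  ultimately show ?case by blast
qed

section \<open>Minimum zero forcing sets of a path\<close>

lemma path_enumeration_rev:
  assumes "path_enumeration G S n f"
  shows "path_enumeration G S n (\<lambda>i. f (n - 1 - i))"
proof -
  have "bij_betw (\<lambda>i. n - 1 - i) {..<n} {..<n}"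
    by (rule bij_betwI[of _ _ _ "\<lambda>i. n - 1 - i"]) auto
  then have "bij_betw (\<lambda>i. f (n - 1 - i)) {..<n} S"
    using bij_betw_trans[of _ "{..<n}" "{..<n}" f S] assms
    by (simp add: path_enumeration_def o_def)
  moreover have "(f (n - 1 - i), f (n - 1 - j)) \<in> parcs G \<longleftrightarrow> j = Suc i \<or> i = Suc j"
    if "i < n" "j < n" for i j
  proof -
    have "(f (n - 1 - i), f (n - 1 - j)) \<in> parcs G \<longleftrightarrow>
        n - 1 - j = Suc (n - 1 - i) \<or> n - 1 - i = Suc (n - 1 - j)"
      using assms that by (simp add: path_enumeration_def)
    then show ?thesis using that by linarith
  qed
  ultimately show ?thesis unfolding path_enumeration_def by blast
qed

text \<open>The blue set runs through the initial segments: the predecessor of \<open>f k\<close> is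
  blue, so \<open>f k\<close> forces its successor.\<close>

lemma path_enumeration_zero_forcing:
  assumes p: "path_enumeration G (pverts G) n f" and "n > 0"
  shows "zero_forcing_set G {f 0}"
proof -
  have f: "f ` {..<n} = pverts G" "inj_on f {..<n}"
    and arcs: "\<And>i j. i < n \<Longrightarrow> j < n \<Longrightarrow> (f i, f j) \<in> parcs G \<longleftrightarrow> j = Suc i \<or> i = Suc j"
    using p by (auto simp: path_enumeration_def bij_betw_def)
  have "(color_change G)\<^sup>*\<^sup>* {f 0} (f ` {..<Suc k})" if "k < n" for k
    using that
  proof (induction k)
    case 0
    then show ?case by (simp add: lessThan_Suc)
  next
    case (Suc k)
    have "white_neighbors G (f ` {..<Suc k}) (f k) = {f (Suc k)}"
    proof (intro equalityI subsetI)
      fix y assume "y \<in> white_neighbors G (f ` {..<Suc k}) (f k)"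
      then have "y \<in> f ` {..<n}" and y: "y \<notin> f ` {..<Suc k}" "(f k, y) \<in> parcs G"
        by (simp_all add: white_neighbors_def f(1))
      then obtain j where "j < n" "y = f j" by blast
      with y show "y \<in> {f (Suc k)}" using arcs[of k j] Suc.prems by auto
    next
      fix y assume "y \<in> {f (Suc k)}"
      moreover have "f (Suc k) \<notin> f ` {..<Suc k}"
        using f(2) Suc.prems by (auto dest!: inj_onD)
      ultimately show "y \<in> white_neighbors G (f ` {..<Suc k}) (f k)"
        using arcs[of k "Suc k"] f(1) Suc.prems by (auto simp: white_neighbors_def)
    qed
    then have "color_change G (f ` {..<Suc k}) (insert (f (Suc k)) (f ` {..<Suc k}))"
      by (intro color_change.force[of "f k"]) auto
    then show ?case using Suc by (simp add: lessThan_Suc rtranclp.rtrancl_into_rtrancl)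
  qed
  from this[of "n - 1"] show ?thesis
    using \<open>n > 0\<close> f(1) by (auto simp: zero_forcing_set_def)
qed

text \<open>An interior vertex starts with two white neighbors and can never force.\<close>

lemma path_enumeration_interior_not_zero_forcing:
  assumes p: "path_enumeration G (pverts G) n f" and "0 < i" "Suc i < n"
  shows "\<not> zero_forcing_set G {f i}"
proof
  assume "zero_forcing_set G {f i}"
  then have "(color_change G)\<^sup>*\<^sup>* {f i} (pverts G)" by (simp add: zero_forcing_set_def)
  moreover have f: "f ` {..<n} = pverts G" "inj_on f {..<n}"
    and arcs: "\<And>i j. i < n \<Longrightarrow> j < n \<Longrightarrow> (f i, f j) \<in> parcs G \<longleftrightarrow> j = Suc i \<or> i = Suc j"
    using p by (auto simp: path_enumeration_def bij_betw_def)
  have ne: "f (i - 1) \<noteq> f i" "f (Suc i) \<noteq> f i" "f (i - 1) \<noteq> f (Suc i)"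
    using assms(2,3) by (auto simp: inj_on_eq_iff[OF f(2)])
  have "f (i - 1) \<in> pverts G" "f (Suc i) \<in> pverts G"
    using assms(2,3) f(1) by auto
  with ne arcs[of i "i - 1"] arcs[of i "Suc i"]
  have mem: "{f (i - 1), f (Suc i)} \<subseteq> white_neighbors G {f i} (f i)"
    using assms(2,3) by (auto simp: white_neighbors_def)
  \<comment> \<open>A vertex is still white, so the process would need a first step.\<close>
  have "pverts G \<noteq> {f i}" using ne(1) \<open>f (i - 1) \<in> pverts G\<close> by auto
  ultimately obtain T where "color_change G {f i} T" by (metis converse_rtranclpE)
  then show False using mem ne(3) by (auto elim!: color_change.cases)
qed

text \<open>The empty set forces nothing, so one vertex is optimal, and among single vertices only
  the ends work. For \<open>n = 1\<close> the two ends coincide.\<close>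

lemma path_enumeration_min_zero_forcing_sets:
  assumes p: "path_enumeration G (pverts G) n f" and n: "n > 0"
  shows "{B. min_zero_forcing_set G B} = {{f 0}, {f (n - 1)}}"
proof -
  have f: "f ` {..<n} = pverts G" using p by (auto simp: path_enumeration_def bij_betw_def)
  then have ne: "pverts G \<noteq> {}" using n by auto
  have fin: "finite (pverts G)" using f by (metis finite_imageI finite_lessThan)
  have ends: "zero_forcing_set G {f 0}" "zero_forcing_set G {f (n - 1)}"
    using path_enumeration_zero_forcing[OF p n]
      path_enumeration_zero_forcing[OF path_enumeration_rev[OF p] n] by simp_all
  have "finite B" if "zero_forcing_set G B" for B
    using that fin by (auto simp: zero_forcing_set_def intro: finite_subset)
  then have "1 \<le> card B" if "zero_forcing_set G B" for B
    using zero_forcing_set_nonempty[OF that ne] that by (simp add: Suc_le_eq card_gt_0_iff)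
  moreover have "card {f 0} = 1" by simp
  ultimately have Z: "zero_forcing_number G = 1"
    unfolding zero_forcing_number_def using ends(1) finite_zero_forcing_sets[OF fin]
    by (intro Min_eqI) (auto intro: rev_image_eqI)
  have "B \<in> {{f 0}, {f (n - 1)}}" if B: "zero_forcing_set G B" "card B = 1" for B
  proof -
    obtain v where v: "B = {v}" using B(2) by (auto simp: card_1_singleton_iff)
    moreover have "v \<in> pverts G" using B(1) v by (simp add: zero_forcing_set_def)
    ultimately obtain i where i: "i < n" "B = {f i}" using f by blast
    then have "i = 0 \<or> i = n - 1"
      using path_enumeration_interior_not_zero_forcing[OF p, of i] B(1) by fastforce
    then show ?thesis using i by auto
  qed
  then show ?thesis using ends Z by (auto simp: min_zero_forcing_set_def)
qed

theorem proposition4p1: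
  fixes G :: "'a pair_pre_digraph"
  assumes "pair_graph G"
    and "connected (with_proj G)"
  shows "complete_digraph 2 (with_proj (zero_forcing_graph G)) \<longleftrightarrow>
         (\<exists>n\<ge>2. graph_iso G (path_graph n))"
proof
  interpret pair_graph G by fact
  assume "complete_digraph 2 (with_proj (zero_forcing_graph G))"
  then have card2: "card {B. min_zero_forcing_set G B} = 2"
    and edges: "{(B, B'). min_zero_forcing_set G B \<and> min_zero_forcing_set G B' \<and>
        card (sym_diff B B') = 2} =
      {(B, B'). min_zero_forcing_set G B \<and> min_zero_forcing_set G B' \<and> B \<noteq> B'}"
    by (auto simp: complete_digraph_pair_def zero_forcing_graph_def)
  then obtain A B where AB: "{B. min_zero_forcing_set G B} = {A, B}" "A \<noteq> B"
    by (meson card_2_iff)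
  have mA: "min_zero_forcing_set G A" and mB: "min_zero_forcing_set G B" using AB(1) by blast+
  then have sd: "card (sym_diff A B) = 2" using edges AB(2) by blast
  have sub: "A \<subseteq> pverts G" "B \<subseteq> pverts G" and eq: "card A = card B"
    using mA mB by (auto simp: min_zero_forcing_set_def zero_forcing_set_def)
  have fin: "finite A" "finite B" using sub pair_finite_verts by (auto intro: finite_subset)
  \<comment> \<open>Two distinct sets of equal size do not fit into one vertex. With connectedness,
    every vertex then has a neighbor.\<close>
  have nontriv: "pverts G \<noteq> {v}" for v
  proof
    assume "pverts G = {v}"
    then have "A = {} \<or> A = {v}" "B = {} \<or> B = {v}" using sub by auto
    then show False using eq AB(2) by auto
  qed
  \<comment> \<open>As \<open>A\<close> and \<open>B\<close> are the only minimum sets, a common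
    vertex would lie in all of them.\<close>
  have "A \<inter> B = {}"
  proof (rule ccontr)
    assume "A \<inter> B \<noteq> {}"
    then obtain v where v: "v \<in> A" "v \<in> B" by blast
    then obtain w where "(v, w) \<in> parcs G"
      using connected_has_neighbor[OF assms(2) _ nontriv] sub by blast
    from min_zero_forcing_set_avoiding[OF mA this] show False using v AB(1) by blast
  qed
  \<comment> \<open>Adjacency of \<open>A\<close> and \<open>B\<close> enters here: for disjoint
    sets the symmetric difference is the union, and equal sizes leave one vertex for each.\<close>
  then have "card (A \<union> B) = 2" using sd by (simp add: Un_Diff_Int Diff_triv Int_commute)
  then have "card A = 1"
    using \<open>A \<inter> B = {}\<close> fin eq by (simp add: card_Un_disjoint)
  then obtain x where "A = {x}" by (auto simp: card_1_singleton_iff)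
  then have "(color_change G)\<^sup>*\<^sup>* {x} (pverts G)"
    using mA by (simp add: min_zero_forcing_set_def zero_forcing_set_def)
  from forcing_chain_path[OF this] obtain n f where
    p: "path_enumeration G (pverts G) (Suc n) f" by blast
  have "n \<noteq> 0"
    using p nontriv[of "f 0"] by (auto simp: path_enumeration_def bij_betw_def lessThan_Suc)
  then show "\<exists>n\<ge>2. graph_iso G (path_graph n)"
    using graph_iso_path_graphI[OF p] by (intro exI[of _ "Suc n"]) auto
next
  interpret pair_graph G by fact
  assume "\<exists>n\<ge>2. graph_iso G (path_graph n)"
  then obtain n f where n: "n \<ge> 2" and p: "path_enumeration G (pverts G) n f"
    using graph_iso_path_graphD by blast
  have mins: "{B. min_zero_forcing_set G B} = {{f 0}, {f (n - 1)}}"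
    using path_enumeration_min_zero_forcing_sets[OF p] n by simp
  then have iff: "min_zero_forcing_set G B \<longleftrightarrow> B = {f 0} \<or> B = {f (n - 1)}" for B by blast
  have "inj_on f {..<n}" using p by (auto simp: path_enumeration_def bij_betw_def)
  \<comment> \<open>From \<open>n \<ge> 2\<close> the ends differ, which gives two vertices of the
    zero forcing graph and the edge between them.\<close>
  then have ne: "f 0 \<noteq> f (n - 1)" using n by (auto simp: inj_on_eq_iff)
  then have "card (sym_diff {f 0} {f (n - 1)}) = 2" "card (sym_diff {f (n - 1)} {f 0}) = 2"
    by (simp_all add: insert_Diff_if)
  then show "complete_digraph 2 (with_proj (zero_forcing_graph G))"
    unfolding complete_digraph_pair_def zero_forcing_graph_def pair_pre_digraph.simps mins
    using ne by (auto simp: iff)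
qed

end
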